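(* A real Banach space $X$ is isomorphic to a Hilbert space if and only if there exists a positive and symmetric linear operator $T:X\to X^\ast$ (defined on all of $X$) with $\cos T>0$.
   Context: $X^\ast$ is the (topological) dual of $X$ and $\langle x^\ast,x\rangle=x^\ast(x)$. "Isomorphic" means linearly homeomorphic. A linear operator $T:X\to X^\ast$ is positive if $\langle Tx,x\rangle\geq 0$ for all $x\in X$, and symmetric if $\langle Tx,y\rangle=\langle Ty,x\rangle$ for all $x,y\in X$. The cosine of a positive linear operator $T:X\to X^\ast$ is $$\cos T=\inf\left\{\frac{\langle Tx,x\rangle}{\|Tx\|\,\|x\|}\;:\; 0\neq x\in X,\ Tx\neq 0\right\}.$$
   Formalization: The operator T is required to be nonzero unless X = {0}, because for T = 0 the infimum defining cos T is over the empty set (taken as infinity), and the claim would then fail for every X not isomorphic to a Hilbert space. *)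

theory Defs
  imports "HOL-Analysis.Analysis"
begin

text \<open>
  A Hilbert space is a real vector space together with an inner product whose induced metric is
  complete.  The inner product is an explicit parameter, and not the one of the type class
  \<^class>\<open>real_inner\<close>, because ``there is a Hilbert space'' has to be an existential statement
  inside the logic.
\<close>

locale inner_product =
  fixes ip :: "'h::real_vector \<Rightarrow> 'h \<Rightarrow> real"
  assumes bilinear: "bilinear ip"
    and sym: "ip x y = ip y x"
    and pos: "x \<noteq> 0 \<Longrightarrow> ip x x > 0"
begin

definition ip_dist :: "'h \<Rightarrow> 'h \<Rightarrow> real"
  where "ip_dist x y = sqrt (ip (x - y) (x - y))"

lemma nonneg: "ip x x \<ge> 0"
  using pos[of x] bilinear_lzero[OF bilinear, of 0] by (cases "x = 0") auto

lemma Cauchy_Schwarz: "(ip x y)\<^sup>2 \<le> ip x x * ip y y"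
proof (cases "y = 0")
  case True
  then show ?thesis using bilinear_rzero[OF bilinear] by simp
next
  case False
  define t where "t = ip x y / ip y y"
  have p: "ip y y > 0" using pos[OF False] .
  have "ip (x - t *\<^sub>R y) (x - t *\<^sub>R y) = ip x x - 2 * t * ip x y + t\<^sup>2 * ip y y"
    by (simp add: bilinear_lsub[OF bilinear] bilinear_rsub[OF bilinear]
        bilinear_lmul[OF bilinear] bilinear_rmul[OF bilinear] sym[of y x] power2_eq_square
        algebra_simps)
  also have "\<dots> = ip x x - (ip x y)\<^sup>2 / ip y y"
    using p by (simp add: t_def power2_eq_square field_simps)
  finally have "0 \<le> ip x x - (ip x y)\<^sup>2 / ip y y"
    using nonneg[of "x - t *\<^sub>R y"] by simp
  then show ?thesis using p by (simp add: field_simps)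
qed

lemma triangle: "sqrt (ip (x + y) (x + y)) \<le> sqrt (ip x x) + sqrt (ip y y)"
proof (rule real_le_lsqrt)
  have "ip x y \<le> sqrt (ip x x * ip y y)"
    using Cauchy_Schwarz[of x y] by (simp add: real_le_rsqrt)
  then show "ip (x + y) (x + y) \<le> (sqrt (ip x x) + sqrt (ip y y))\<^sup>2"
    using nonneg[of x] nonneg[of y]
    by (simp add: bilinear_ladd[OF bilinear] bilinear_radd[OF bilinear] sym[of y x]
        power2_sum real_sqrt_mult)
qed (use nonneg in simp_all)

sublocale Metric_space UNIV ip_dist
proof
  show "0 \<le> ip_dist x y" for x y
    by (simp add: ip_dist_def nonneg)
  show "ip_dist x y = ip_dist y x" for x y
    using bilinear_lneg[OF bilinear, of "x - y"] bilinear_rneg[OF bilinear, of _ "x - y"]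
    by (simp add: ip_dist_def)
  show "ip_dist x y = 0 \<longleftrightarrow> x = y" for x y
    using pos[of "x - y"] bilinear_lzero[OF bilinear, of 0]
    by (cases "x = y") (auto simp: ip_dist_def)
  show "ip_dist x z \<le> ip_dist x y + ip_dist y z" for x y z
    using triangle[of "x - y" "y - z"] by (simp add: ip_dist_def)
qed

end

locale hilbert_space = inner_product +
  assumes complete: mcomplete

text \<open>
  In the definition below the Hilbert space is carried by the type of the given normed space.  This
  loses no generality, since a Hilbert space linearly homeomorphic to the normed space can be
  transported to it along the homeomorphism; see the two lemmas that follow.
\<close>

definition isomorphic_to_hilbert_space :: "'a::real_normed_vector itself \<Rightarrow> bool"
  where "isomorphic_to_hilbert_space _ \<longleftrightarrow>
    (\<exists>(ip :: 'a \<Rightarrow> 'a \<Rightarrow> real) (f :: 'a \<Rightarrow> 'a).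
      hilbert_space ip \<and> linear f \<and>
      homeomorphic_map euclidean (Metric_space.mtopology UNIV (inner_product.ip_dist ip)) f)"

lemma isomorphic_to_hilbert_spaceI:
  fixes ip :: "'h::real_vector \<Rightarrow> 'h \<Rightarrow> real"
    and f :: "'a::real_normed_vector \<Rightarrow> 'h"
  assumes "hilbert_space ip" and f: "linear f"
    and hom: "homeomorphic_map euclidean (Metric_space.mtopology UNIV (inner_product.ip_dist ip)) f"
  shows "isomorphic_to_hilbert_space TYPE('a)"
proof -
  interpret H: hilbert_space ip by fact
  have bij: "bij f"
    using hom by (simp add: homeomorphic_eq_everything_map bij_def)
  define ip' where "ip' x y = ip (f x) (f y)" for x y
  interpret P: inner_product ip'
  proof
    show "bilinear ip'"
      using H.bilinear linear_compose[OF f]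
      by (auto simp: bilinear_def ip'_def o_def)
    show "ip' x y = ip' y x" for x y
      by (simp add: ip'_def H.sym)
    show "ip' x x > 0" if "x \<noteq> 0" for x
    proof -
      have "f x \<noteq> 0"
        using that bij linear_0[OF f] by (metis bij_def injD)
      then show ?thesis by (simp add: ip'_def H.pos)
    qed
  qed
  have d: "P.ip_dist x y = H.ip_dist (f x) (f y)" for x y
    by (simp add: P.ip_dist_def H.ip_dist_def ip'_def linear_diff[OF f])
  interpret M: Metric_space12 UNIV P.ip_dist UNIV H.ip_dist
    by unfold_locales
  have iso: "homeomorphic_map P.mtopology H.mtopology f"
    using bij by (intro M.isometry_imp_homeomorphic_map) (auto simp: d bij_def)
  have "P.mcomplete"
    unfolding P.mcomplete_def
  proof (intro allI impI)
    fix s assume "P.MCauchy s"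
    then have "H.MCauchy (f \<circ> s)"
      by (simp add: P.MCauchy_def H.MCauchy_def d)
    then obtain l where l: "limitin H.mtopology (f \<circ> s) l sequentially"
      using H.complete H.mcomplete_def by blast
    obtain x where "l = f x" using bij by (metis bij_pointE)
    with l have "limitin P.mtopology s x sequentially"
      by (simp add: H.limit_metric_sequentially P.limit_metric_sequentially d)
    then show "\<exists>x. limitin P.mtopology s x sequentially" ..
  qed
  then have "hilbert_space ip'"
    by unfold_locales
  moreover have "homeomorphic_map euclidean P.mtopology id"
  proof -
    obtain g where g: "homeomorphic_maps P.mtopology H.mtopology f g"
      using iso homeomorphic_map_maps by blast
    then have "homeomorphic_map euclidean P.mtopology (g \<circ> f)"
      by (metis hom homeomorphic_map_compose homeomorphic_maps_map)
    moreover have "g \<circ> f = id"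
      using g by (auto simp: homeomorphic_maps_def)
    ultimately show ?thesis by simp
  qed
  ultimately show ?thesis
    unfolding isomorphic_to_hilbert_space_def using linear_id by blast
qed

lemma hilbert_space_inner:
  "hilbert_space (inner :: 'h::{real_inner,complete_space} \<Rightarrow> 'h \<Rightarrow> real)"
proof -
  interpret P: inner_product "inner :: 'h \<Rightarrow> 'h \<Rightarrow> real"
    by unfold_locales
      (auto simp: bilinear_conv_bounded_bilinear inner_commute bilinear_def
        intro: bounded_linear.linear bounded_linear_inner_left bounded_linear_inner_right)
  have "P.ip_dist = dist"
    by (simp add: fun_eq_iff P.ip_dist_def dist_norm norm_eq_sqrt_inner)
  then have "P.mcomplete"
    by (simp add: complete_UNIV)
  then show ?thesis by unfold_locales
qed

text \<open>
  The dual of \<open>'a\<close> is the type \<open>'a \<Rightarrow>\<^sub>L real\<close> of bounded linear functionals with the operator norm.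
\<close>

definition positive_operator :: "('a::real_normed_vector \<Rightarrow> 'a \<Rightarrow>\<^sub>L real) \<Rightarrow> bool"
  where "positive_operator T \<longleftrightarrow> (\<forall>x. blinfun_apply (T x) x \<ge> 0)"

definition symmetric_operator :: "('a::real_normed_vector \<Rightarrow> 'a \<Rightarrow>\<^sub>L real) \<Rightarrow> bool"
  where "symmetric_operator T \<longleftrightarrow> (\<forall>x y. blinfun_apply (T x) y = blinfun_apply (T y) x)"

text \<open>
  The infimum is taken in the extended reals; over the empty set, i.e. for \<open>T = 0\<close>, it is \<open>\<infinity>\<close>.
\<close>

definition operator_cos :: "('a::real_normed_vector \<Rightarrow> 'a \<Rightarrow>\<^sub>L real) \<Rightarrow> ereal"
  where "operator_cos T =
    (INF x \<in> {x. x \<noteq> 0 \<and> T x \<noteq> 0}. ereal (blinfun_apply (T x) x / (norm (T x) * norm x)))"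

end

theory Submission
  imports Defs
begin

text \<open>
  For a positive symmetric \<open>T\<close> write \<open>q x\<close> for the value of the functional \<open>T x\<close> at \<open>x\<close>.
  Nonzero operators of positive cosine correspond to inner products whose norm
  \<open>\<surd>q\<close> is equivalent to the given norm; on a Banach space such an inner product is complete and
  induces the original topology (\<open>isomorphic_to_hilbert_space_iff_equivalent_inner_product\<close>).

  If \<open>\<parallel>x\<parallel> \<le> m \<surd>(q x)\<close> and \<open>\<surd>(q x) \<le> M \<parallel>x\<parallel>\<close>, the inner product is bounded, hence is given by an
  operator into the dual, and the cosine of this operator is at least \<open>1 / (m M)\<^sup>2\<close>.

  Conversely, \<open>cos T > 0\<close> gives a \<open>c > 0\<close> with \<open>c \<parallel>T x\<parallel> \<parallel>x\<parallel> \<le> q x\<close>.  The idea is to translate by a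
  fixed vector \<open>y\<close> with \<open>T y \<noteq> 0\<close>.  The parallelogram law bounds \<open>q (x + y)\<close>, and hence the product
  \<open>\<parallel>T (x + y)\<parallel> \<parallel>x + y\<parallel>\<close>, uniformly over the set \<open>q x < 1\<close>.
  If \<open>x\<close> is large in that set, then \<open>T x\<close> is small, so \<open>T (x + y)\<close> stays away from \<open>0\<close>,
  which limits \<open>\<parallel>x + y\<parallel>\<close>; if \<open>T x\<close> is large, then \<open>x\<close> is small and the same argument with the
  factors exchanged limits \<open>\<parallel>T (x + y)\<parallel>\<close>.  Thus both \<open>\<parallel>x\<parallel>\<close> and \<open>\<parallel>T x\<parallel>\<close> are bounded on
  \<open>q x < 1\<close>, that is, both are dominated by \<open>\<surd>q\<close>.  The first domination makes \<open>q\<close> definite, and the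
  second gives \<open>q x \<le> \<parallel>T x\<parallel> \<parallel>x\<parallel> \<le> M \<surd>(q x) \<parallel>x\<parallel>\<close>, the reverse estimate.  The two
  bounds together also show that \<open>T\<close> is continuous.
\<close>

section \<open>Homogeneous functions and quadratic forms\<close>

text \<open>
  This converts bounds on balls into inequalities between gauges.  The factor 2 comes from scaling
  to the inside of the open ball; where \<open>p\<close> vanishes, all multiples lie in the ball, which forces
  \<open>h \<le> 0\<close>.
\<close>

lemma homogeneous_le_if_bounded_on_ball:
  fixes p h :: "'a::real_vector \<Rightarrow> real"
  assumes p: "\<And>t x. p (t *\<^sub>R x) = \<bar>t\<bar> * p x" and h: "\<And>t x. h (t *\<^sub>R x) = \<bar>t\<bar> * h x"
    and nonneg: "\<And>x. p x \<ge> 0" and "r > 0" and bound: "\<And>x. p x < r \<Longrightarrow> h x \<le> b"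
  shows "h x \<le> 2 * b / r * p x"
proof (cases "p x = 0")
  case True
  have "h x \<le> 0"
  proof (rule ccontr)
    assume "\<not> h x \<le> 0"
    have "h (((\<bar>b\<bar> + 1) / h x) *\<^sub>R x) \<le> b"
      using True p \<open>r > 0\<close> by (intro bound) simp
    then show False
      using \<open>\<not> h x \<le> 0\<close> by (simp add: h)
  qed
  then show ?thesis using True by simp
next
  case False
  with nonneg[of x] have "p x > 0" by simp
  then have "h ((r / (2 * p x)) *\<^sub>R x) \<le> b"
    using \<open>r > 0\<close> by (intro bound) (simp add: p)
  then show ?thesis
    using \<open>p x > 0\<close> \<open>r > 0\<close> by (simp add: h field_simps)
qed

lemma bilinear_diagonal_scaleR:
  assumes "bilinear B"
  shows "B (t *\<^sub>R x) (t *\<^sub>R x) = t\<^sup>2 * B x x"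
  by (simp add: bilinear_lmul[OF assms] bilinear_rmul[OF assms] power2_eq_square)

lemma sqrt_bilinear_diagonal_scaleR:
  assumes "bilinear B"
  shows "sqrt (B (t *\<^sub>R x) (t *\<^sub>R x)) = \<bar>t\<bar> * sqrt (B x x)"
  by (simp add: bilinear_diagonal_scaleR[OF assms] real_sqrt_mult)

section \<open>Inner products equivalent to the norm\<close>

definition equivalent_inner_product :: "('a::real_normed_vector \<Rightarrow> 'a \<Rightarrow> real) \<Rightarrow> bool"
  where "equivalent_inner_product ip \<longleftrightarrow> inner_product ip \<and>
    (\<exists>m>0. \<exists>M>0. \<forall>x. norm x \<le> m * sqrt (ip x x) \<and> sqrt (ip x x) \<le> M * norm x)"

text \<open>
  The inner product of the Hilbert space is pulled back along the isomorphism.  The equivalence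
  constants are read off from the images and preimages of unit balls.
\<close>

lemma isomorphic_imp_equivalent_inner_product:
  assumes "isomorphic_to_hilbert_space TYPE('a::real_normed_vector)"
  shows "\<exists>ip :: 'a \<Rightarrow> 'a \<Rightarrow> real. equivalent_inner_product ip"
proof -
  from assms obtain ip :: "'a \<Rightarrow> 'a \<Rightarrow> real" and f :: "'a \<Rightarrow> 'a"
    where "hilbert_space ip" and f: "linear f"
      and hom: "homeomorphic_map euclidean
        (Metric_space.mtopology UNIV (inner_product.ip_dist ip)) f"
    unfolding isomorphic_to_hilbert_space_def by blast
  interpret H: hilbert_space ip by fact
  have inj: "inj f" and cont: "continuous_map euclidean H.mtopology f"
    and opn: "open_map euclidean H.mtopology f"
    using hom by (auto simp: homeomorphic_eq_everything_map)
  define B where "B x y = ip (f x) (f y)" for x y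
  have B: "bilinear B"
    using H.bilinear linear_compose[OF f] by (auto simp: bilinear_def B_def o_def)
  have d: "H.ip_dist 0 (f x) = sqrt (B x x)" for x
    by (subst H.commute) (simp add: H.ip_dist_def B_def)
  have "inner_product B"
  proof
    show "B x x > 0" if "x \<noteq> 0" for x
      using that inj linear_0[OF f] H.pos unfolding B_def by (metis injD)
  qed (use B H.sym in \<open>auto simp: B_def\<close>)
  moreover obtain M where "M > 0" and M: "\<And>x. sqrt (B x x) \<le> M * norm x"
  proof -
    have "open {x. f x \<in> H.mball 0 1}"
      using openin_continuous_map_preimage[OF cont H.openin_mball[of 0 1]] by simp
    moreover have "0 \<in> {x. f x \<in> H.mball 0 1}"
      by (simp add: linear_0[OF f])
    ultimately obtain r where "r > 0" and r: "ball 0 r \<subseteq> {x. f x \<in> H.mball 0 1}"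
      by (meson open_contains_ball)
    have "sqrt (B x x) \<le> 2 * 1 / r * norm x" for x
    proof (rule homogeneous_le_if_bounded_on_ball[OF _ sqrt_bilinear_diagonal_scaleR[OF B]])
      show "sqrt (B z z) \<le> 1" if "norm z < r" for z
        using r that by (force simp: d[symmetric])
    qed (use \<open>r > 0\<close> in auto)
    then show thesis using that[of "2 / r"] \<open>r > 0\<close> by simp
  qed
  moreover obtain m where "m > 0" and m: "\<And>x. norm x \<le> m * sqrt (B x x)"
  proof -
    have "openin H.mtopology (f ` ball 0 1)"
      using opn by (simp add: open_map_def)
    moreover have "0 \<in> f ` ball 0 1"
      using linear_0[OF f] by force
    ultimately obtain r where "r > 0" and r: "H.mball 0 r \<subseteq> f ` ball 0 1"
      by (metis H.openin_mtopology)
    have "norm x \<le> 2 * 1 / r * sqrt (B x x)" for x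
    proof (rule homogeneous_le_if_bounded_on_ball[OF sqrt_bilinear_diagonal_scaleR[OF B]])
      show "norm z \<le> 1" if "sqrt (B z z) < r" for z
      proof -
        have "f z \<in> f ` ball 0 1"
          using r that by (force simp: d[symmetric])
        then show ?thesis by (simp add: inj_image_mem_iff[OF inj])
      qed
    qed (use \<open>r > 0\<close> H.nonneg in \<open>auto simp: B_def\<close>)
    then show thesis using that[of "2 / r"] \<open>r > 0\<close> by simp
  qed
  ultimately have "equivalent_inner_product B"
    unfolding equivalent_inner_product_def by (intro conjI exI[of _ m] exI[of _ M]) simp_all
  then show ?thesis by (rule exI[of _ B])
qed

text \<open>
  Equivalent norms have the same open sets, Cauchy sequences and limits, so the identity is an
  isomorphism and completeness is inherited.
\<close>

lemma equivalent_inner_product_imp_isomorphic: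
  fixes ip :: "'a::banach \<Rightarrow> 'a \<Rightarrow> real"
  assumes "equivalent_inner_product ip"
  shows "isomorphic_to_hilbert_space TYPE('a)"
proof -
  from assms obtain m M where "inner_product ip" "m > 0" "M > 0"
    and "\<And>x. norm x \<le> m * sqrt (ip x x)" "\<And>x. sqrt (ip x x) \<le> M * norm x"
    unfolding equivalent_inner_product_def by blast
  interpret P: inner_product ip by fact
  have m: "dist x y \<le> m * P.ip_dist x y" and M: "P.ip_dist x y \<le> M * dist x y" for x y
    using \<open>\<And>x. norm x \<le> _\<close> \<open>\<And>x. sqrt _ \<le> _\<close> by (auto simp: P.ip_dist_def dist_norm)
  have small_m: "dist x y < e" if "P.ip_dist x y < e / m" for x y e
    using m[of x y] that \<open>m > 0\<close> by (simp add: field_simps)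
  have small_M: "P.ip_dist x y < e" if "dist x y < e / M" for x y e
    using M[of x y] that \<open>M > 0\<close> by (simp add: field_simps)
  have "openin P.mtopology U \<longleftrightarrow> open U" for U
  proof
    assume U: "openin P.mtopology U"
    show "open U"
      unfolding open_contains_ball
    proof
      fix x assume "x \<in> U"
      then obtain r where "r > 0" "P.mball x r \<subseteq> U"
        using U by (auto simp: P.openin_mtopology)
      then show "\<exists>e>0. ball x e \<subseteq> U"
        using \<open>M > 0\<close> small_M[of x _ r] by (intro exI[of _ "r / M"]) auto
    qed
  next
    assume U: "open U"
    show "openin P.mtopology U"
      unfolding P.openin_mtopology
    proof (intro conjI allI impI)
      fix x assume "x \<in> U"
      then obtain r where "r > 0" "ball x r \<subseteq> U"
        using U by (auto simp: open_contains_ball)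
      then show "\<exists>e>0. P.mball x e \<subseteq> U"
        using \<open>m > 0\<close> small_m[of x _ r] by (intro exI[of _ "r / m"]) auto
    qed simp
  qed
  then have "P.mtopology = euclidean"
    by (simp add: topology_eq)
  then have "homeomorphic_map euclidean P.mtopology id"
    by simp
  moreover have "P.mcomplete"
    unfolding P.mcomplete_def
  proof (intro allI impI)
    fix s assume s: "P.MCauchy s"
    have "Cauchy s"
    proof (rule metric_CauchyI)
      fix e :: real assume "e > 0"
      then have "e / m > 0" using \<open>m > 0\<close> by simp
      then show "\<exists>N. \<forall>k\<ge>N. \<forall>l\<ge>N. dist (s k) (s l) < e"
        using s small_m unfolding P.MCauchy_def by meson
    qed
    then obtain l where "s \<longlonglongrightarrow> l"
      using Cauchy_convergent convergent_def by blast
    then show "\<exists>l. limitin P.mtopology s l sequentially"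
      using \<open>P.mtopology = euclidean\<close> by auto
  qed
  then have "hilbert_space ip"
    by unfold_locales
  ultimately show ?thesis
    unfolding isomorphic_to_hilbert_space_def using linear_id by blast
qed

lemma isomorphic_to_hilbert_space_iff_equivalent_inner_product:
  "isomorphic_to_hilbert_space TYPE('a::banach) \<longleftrightarrow>
    (\<exists>ip :: 'a \<Rightarrow> 'a \<Rightarrow> real. equivalent_inner_product ip)"
  using isomorphic_imp_equivalent_inner_product equivalent_inner_product_imp_isomorphic by blast

section \<open>Operators of positive cosine\<close>

text \<open>
  Without the quotient the condition makes sense at every vector and for every operator, including
  those whose cosine is the infinite infimum over the empty set.
\<close>

lemma operator_cos_pos_iff:
  assumes "positive_operator T"
  shows "operator_cos T > 0 \<longleftrightarrow>
    (\<exists>c>0. \<forall>x. c * norm (T x) * norm x \<le> blinfun_apply (T x) x)"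
proof
  assume "operator_cos T > 0"
  then obtain c where "0 < ereal c" and c: "ereal c < operator_cos T"
    using ereal_dense2 by blast
  have "c * norm (T x) * norm x \<le> blinfun_apply (T x) x" for x
  proof (cases "x = 0 \<or> T x = 0")
    case True
    then show ?thesis by auto
  next
    case False
    then have "ereal c \<le> ereal (blinfun_apply (T x) x / (norm (T x) * norm x))"
      by (intro order_trans[OF less_imp_le[OF c[unfolded operator_cos_def]]] INF_lower) simp
    then show ?thesis
      using False by (simp add: field_simps)
  qed
  then show "\<exists>c>0. \<forall>x. c * norm (T x) * norm x \<le> blinfun_apply (T x) x"
    using \<open>0 < ereal c\<close> by auto
next
  assume "\<exists>c>0. \<forall>x. c * norm (T x) * norm x \<le> blinfun_apply (T x) x"
  then obtain c where "c > 0" and c: "\<And>x. c * norm (T x) * norm x \<le> blinfun_apply (T x) x"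
    by blast
  have "ereal c \<le> operator_cos T"
    unfolding operator_cos_def
  proof (rule INF_greatest)
    fix x assume "x \<in> {x. x \<noteq> 0 \<and> T x \<noteq> 0}"
    then show "ereal c \<le> ereal (blinfun_apply (T x) x / (norm (T x) * norm x))"
      using c[of x] by (simp add: field_simps)
  qed
  moreover have "0 < ereal c" using \<open>c > 0\<close> by simp
  ultimately show "operator_cos T > 0" by order
qed

lemma equivalent_inner_product_imp_operator:
  fixes ip :: "'a::real_normed_vector \<Rightarrow> 'a \<Rightarrow> real"
  assumes "equivalent_inner_product ip"
  obtains T :: "'a \<Rightarrow> 'a \<Rightarrow>\<^sub>L real"
  where "linear T" "positive_operator T" "symmetric_operator T"
    "\<And>x. x \<noteq> 0 \<Longrightarrow> T x \<noteq> 0" "operator_cos T > 0"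
proof -
  from assms obtain m M where "inner_product ip" "m > 0" "M > 0"
    and m: "\<And>x. norm x \<le> m * sqrt (ip x x)" and M: "\<And>x. sqrt (ip x x) \<le> M * norm x"
    unfolding equivalent_inner_product_def by blast
  interpret P: inner_product ip by fact
  have bound: "\<bar>ip x y\<bar> \<le> M\<^sup>2 * norm x * norm y" for x y
  proof -
    have "\<bar>ip x y\<bar> \<le> sqrt (ip x x * ip y y)"
      using P.Cauchy_Schwarz by (simp add: real_le_rsqrt)
    also have "\<dots> = sqrt (ip x x) * sqrt (ip y y)"
      by (simp add: real_sqrt_mult)
    also have "\<dots> \<le> (M * norm x) * (M * norm y)"
      using \<open>M > 0\<close> P.nonneg by (intro mult_mono M) auto
    finally show ?thesis by (simp add: power2_eq_square mult_ac)
  qed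
  define T where "T x = Blinfun (ip x)" for x
  have T: "blinfun_apply (T x) = ip x" for x
    unfolding T_def
  proof (rule bounded_linear_Blinfun_apply, rule bounded_linear_intro)
    show "norm (ip x y) \<le> norm y * (M\<^sup>2 * norm x)" for y
      using bound[of x y] by (simp add: mult_ac)
  qed (simp_all add: bilinear_radd[OF P.bilinear] bilinear_rmul[OF P.bilinear])
  have "linear T"
    by (rule linearI; rule blinfun_eqI)
      (simp_all add: T blinfun.add_left blinfun.scaleR_left
        bilinear_ladd[OF P.bilinear] bilinear_lmul[OF P.bilinear])
  moreover have pos: "positive_operator T"
    by (simp add: positive_operator_def T P.nonneg)
  moreover have "symmetric_operator T"
    by (simp add: symmetric_operator_def T P.sym)
  moreover have "T x \<noteq> 0" if "x \<noteq> 0" for x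
    
  proof
    assume "T x = 0"
    then have "ip x x = 0" by (simp add: T[symmetric])
    with P.pos[OF that] show False by simp
  qed
  moreover have "operator_cos T > 0"
    unfolding operator_cos_pos_iff[OF pos]
  proof (intro exI[of _ "1 / (m * M)\<^sup>2"] conjI allI)
    fix x
    have "norm (T x) \<le> M\<^sup>2 * norm x"
      using bound by (intro norm_blinfun_bound) (auto simp: T)
    then have "norm (T x) * norm x \<le> M\<^sup>2 * (norm x)\<^sup>2"
      using mult_right_mono[of "norm (T x)" "M\<^sup>2 * norm x" "norm x"]
      by (simp add: power2_eq_square mult_ac)
    also have "\<dots> \<le> M\<^sup>2 * (m * sqrt (ip x x))\<^sup>2"
      by (intro mult_left_mono power_mono m) auto
    also have "\<dots> = (m * M)\<^sup>2 * ip x x"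
      by (simp add: power_mult_distrib P.nonneg)
    finally show "1 / (m * M)\<^sup>2 * norm (T x) * norm x \<le> blinfun_apply (T x) x"
      using \<open>m > 0\<close> \<open>M > 0\<close> by (simp add: T field_simps)
  qed (use \<open>m > 0\<close> \<open>M > 0\<close> in simp)
  ultimately show thesis using that by blast
qed

text \<open>
  If \<open>u\<close> is large, the first product makes \<open>v\<close> small, so \<open>v + v0\<close> stays away from \<open>0\<close> and the second
  product limits \<open>u + u0\<close>.  The pair \<open>(u, v)\<close> will be \<open>(x, T x)\<close> and \<open>(T x, x)\<close>, which is why the two
  vectors may lie in different spaces.
\<close>

lemma norm_bound_by_translated_product:
  fixes u u0 :: "'a::real_normed_vector" and v v0 :: "'b::real_normed_vector"
  assumes "c > 0" "v0 \<noteq> 0"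
    and product: "c * norm v * norm u \<le> 1"
    and translated: "c * norm (v + v0) * norm (u + u0) \<le> R"
  shows "norm u \<le> 2 / (c * norm v0) + norm u0 + 2 * R / (c * norm v0)"
proof -
  have "norm v0 > 0" using \<open>v0 \<noteq> 0\<close> by simp
  have "0 \<le> c * norm (v + v0) * norm (u + u0)" using \<open>c > 0\<close> by simp
  with translated have "R \<ge> 0" by linarith
  show ?thesis
  proof (cases "norm v \<le> norm v0 / 2")
    case True
    have "norm (v + v0) \<ge> norm v0 / 2"
      using True norm_triangle_ineq2[of v0 "- v"] by (simp add: add.commute)
    then have "c * (norm v0 / 2) * norm (u + u0) \<le> R"
      using \<open>c > 0\<close> by (intro order_trans[OF _ translated] mult_right_mono mult_left_mono) auto
    then have "norm (u + u0) \<le> 2 * R / (c * norm v0)"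
      using \<open>c > 0\<close> \<open>norm v0 > 0\<close> by (simp add: field_simps)
    moreover have "norm u \<le> norm (u + u0) + norm u0"
      using norm_triangle_ineq4[of "u + u0" u0] by simp
    moreover have "0 \<le> 2 / (c * norm v0)" using \<open>c > 0\<close> by simp
    ultimately show ?thesis by linarith
  next
    case False
    then have "c * (norm v0 / 2) * norm u \<le> 1"
      using \<open>c > 0\<close> by (intro order_trans[OF _ product] mult_right_mono mult_left_mono) auto
    then have "norm u \<le> 2 / (c * norm v0)"
      using \<open>c > 0\<close> \<open>norm v0 > 0\<close> by (simp add: field_simps)
    moreover have "0 \<le> 2 * R / (c * norm v0)" using \<open>c > 0\<close> \<open>R \<ge> 0\<close> by simp
    ultimately show ?thesis by (simp add: add_increasing2)
  qed
qed

lemma operator_imp_equivalent_inner_product: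
  fixes T :: "'a::real_normed_vector \<Rightarrow> 'a \<Rightarrow>\<^sub>L real"
  assumes T: "linear T" and pos: "positive_operator T" and sym: "symmetric_operator T"
    and cos: "operator_cos T > 0" and "T y \<noteq> 0"
  shows "equivalent_inner_product (\<lambda>x z. blinfun_apply (T x) z)"
proof -
  define B where "B x z = blinfun_apply (T x) z" for x z
  have B: "bilinear B"
    unfolding bilinear_def B_def
    by (auto intro!: linearI simp: linear_add[OF T] linear_scale[OF T] blinfun.bilinear_simps)
  have nonneg: "B x x \<ge> 0" for x
    using pos by (simp add: positive_operator_def B_def)
  obtain c where "c > 0" and c: "\<And>x. c * norm (T x) * norm x \<le> B x x"
    using cos unfolding operator_cos_pos_iff[OF pos] B_def by blast
  have "y \<noteq> 0" using \<open>T y \<noteq> 0\<close> linear_0[OF T] by auto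
  define R where "R = 2 + 2 * B y y"
  have product: "c * norm (T x) * norm x \<le> 1"
    and translated: "c * norm (T x + T y) * norm (x + y) \<le> R" if "sqrt (B x x) < 1" for x
  proof -
    have "B x x \<le> 1" using that by simp
    then show "c * norm (T x) * norm x \<le> 1" using c[of x] by linarith
    \<comment> \<open>The parallelogram law only uses \<open>q \<ge> 0\<close>; definiteness is still to be derived.\<close>
    have "B (x + y) (x + y) + B (x - y) (x - y) = 2 * B x x + 2 * B y y"
      by (simp add: bilinear_ladd[OF B] bilinear_radd[OF B] bilinear_lsub[OF B] bilinear_rsub[OF B])
    then have "B (x + y) (x + y) \<le> R"
      using nonneg[of "x - y"] \<open>B x x \<le> 1\<close> by (simp add: R_def)
    then show "c * norm (T x + T y) * norm (x + y) \<le> R"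
      using c[of "x + y"] by (simp add: linear_add[OF T])
  qed
  define m where "m = 2 / (c * norm (T y)) + norm y + 2 * R / (c * norm (T y))"
  define M where "M = 2 / (c * norm y) + norm (T y) + 2 * R / (c * norm y)"
  have "R \<ge> 0" using nonneg by (simp add: R_def)
  then have "m > 0" "M > 0"
    using \<open>c > 0\<close> \<open>y \<noteq> 0\<close> \<open>T y \<noteq> 0\<close> by (auto simp: m_def M_def intro!: add_pos_nonneg)
  have m: "norm x \<le> 2 * m / 1 * sqrt (B x x)" for x
  proof (rule homogeneous_le_if_bounded_on_ball[OF sqrt_bilinear_diagonal_scaleR[OF B]])
    show "norm z \<le> m" if "sqrt (B z z) < 1" for z
      unfolding m_def
      using \<open>c > 0\<close> \<open>T y \<noteq> 0\<close> product[OF that] translated[OF that]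
      by (rule norm_bound_by_translated_product)
  qed (use nonneg in auto)
  have M: "norm (T x) \<le> 2 * M / 1 * sqrt (B x x)" for x
  proof (rule homogeneous_le_if_bounded_on_ball[OF sqrt_bilinear_diagonal_scaleR[OF B]])
    show "norm (T z) \<le> M" if "sqrt (B z z) < 1" for z
      unfolding M_def
    proof (rule norm_bound_by_translated_product[OF \<open>c > 0\<close> \<open>y \<noteq> 0\<close>])
      show "c * norm z * norm (T z) \<le> 1"
        using product[OF that] by (simp add: mult_ac)
      show "c * norm (z + y) * norm (T z + T y) \<le> R"
        using translated[OF that] by (simp add: mult_ac)
    qed
  qed (use nonneg in \<open>auto simp: linear_scale[OF T]\<close>)
  have "inner_product B"
  proof
    show "bilinear B" by fact
    show "B x z = B z x" for x z
      using sym by (simp add: symmetric_operator_def B_def)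
    show "B x x > 0" if "x \<noteq> 0" for x
      using m[of x] that nonneg[of x] by (cases "B x x = 0") auto
  qed
  moreover have "sqrt (B x x) \<le> 2 * M * norm x" for x
  proof (cases "B x x = 0")
    case True
    then show ?thesis using \<open>M > 0\<close> by simp
  next
    case False
    with nonneg[of x] have "sqrt (B x x) > 0" by simp
    have "sqrt (B x x) * sqrt (B x x) = B x x"
      using nonneg by simp
    also have "\<dots> \<le> norm (T x) * norm x"
      using norm_blinfun[of "T x" x] by (simp add: B_def)
    also have "\<dots> \<le> sqrt (B x x) * (2 * M * norm x)"
      using mult_right_mono[OF M[of x] norm_ge_zero[of x]] by (simp add: mult_ac)
    finally show ?thesis
      using \<open>sqrt (B x x) > 0\<close> by (rule mult_left_le_imp_le)
  qed
  moreover have "norm x \<le> 2 * m * sqrt (B x x)" for x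
    using m[of x] by simp
  ultimately have "equivalent_inner_product B"
    using \<open>m > 0\<close> \<open>M > 0\<close> unfolding equivalent_inner_product_def
    by (intro conjI exI[of _ "2 * m"] exI[of _ "2 * M"]) auto
  then show ?thesis by (simp add: B_def[abs_def])
qed

(* The clause on nonzero vectors excludes T = 0 on a nonzero space, where the infimum defining the
   cosine is over the empty set. *)
theorem corollary4p7:
  shows "isomorphic_to_hilbert_space TYPE('a::banach) \<longleftrightarrow>
    (\<exists>T :: 'a \<Rightarrow> 'a \<Rightarrow>\<^sub>L real.
      linear T \<and> positive_operator T \<and> symmetric_operator T \<and>
      ((\<exists>x::'a. x \<noteq> 0) \<longrightarrow> (\<exists>x. T x \<noteq> 0)) \<and>
      operator_cos T > 0)"
  unfolding isomorphic_to_hilbert_space_iff_equivalent_inner_product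
proof
  assume "\<exists>ip :: 'a \<Rightarrow> 'a \<Rightarrow> real. equivalent_inner_product ip"
  then obtain ip :: "'a \<Rightarrow> 'a \<Rightarrow> real" where "equivalent_inner_product ip" ..
  then obtain T :: "'a \<Rightarrow> 'a \<Rightarrow>\<^sub>L real" where "linear T" "positive_operator T"
    "symmetric_operator T" "\<And>x. x \<noteq> 0 \<Longrightarrow> T x \<noteq> 0" "operator_cos T > 0"
    by (rule equivalent_inner_product_imp_operator) blast
  then show "\<exists>T :: 'a \<Rightarrow> 'a \<Rightarrow>\<^sub>L real.
      linear T \<and> positive_operator T \<and> symmetric_operator T \<and>
      ((\<exists>x::'a. x \<noteq> 0) \<longrightarrow> (\<exists>x. T x \<noteq> 0)) \<and> operator_cos T > 0"
    by blast
next
  assume "\<exists>T :: 'a \<Rightarrow> 'a \<Rightarrow>\<^sub>L real.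
      linear T \<and> positive_operator T \<and> symmetric_operator T \<and>
      ((\<exists>x::'a. x \<noteq> 0) \<longrightarrow> (\<exists>x. T x \<noteq> 0)) \<and> operator_cos T > 0"
  then obtain T :: "'a \<Rightarrow> 'a \<Rightarrow>\<^sub>L real" where T: "linear T" "positive_operator T"
    "symmetric_operator T" "operator_cos T > 0" and nz: "(\<exists>x::'a. x \<noteq> 0) \<longrightarrow> (\<exists>x. T x \<noteq> 0)"
    by (elim exE conjE) (rule that)
  show "\<exists>ip :: 'a \<Rightarrow> 'a \<Rightarrow> real. equivalent_inner_product ip"
  proof (cases "\<exists>x::'a. x \<noteq> 0")
    case True
    with nz obtain y where "T y \<noteq> 0" by blast
    with T have "equivalent_inner_product (\<lambda>x z. blinfun_apply (T x) z)"
      by (intro operator_imp_equivalent_inner_product)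
    then show ?thesis by (rule exI[of _ "\<lambda>x z. blinfun_apply (T x) z"])
  next
    \<comment> \<open>On the zero space no translation vector exists, but the zero form is an inner product.\<close>
    case False
    then have zero: "x = 0" for x :: 'a by blast
    have "inner_product (\<lambda>x z :: 'a. 0)"
      by unfold_locales (use zero in \<open>auto simp: bilinear_def intro: linearI\<close>)
    moreover have "norm x = 0" for x :: 'a by (simp add: zero[of x])
    ultimately have "equivalent_inner_product (\<lambda>x z :: 'a. 0)"
      unfolding equivalent_inner_product_def by (auto intro: exI[of _ 1])
    then show ?thesis by (rule exI[of _ "\<lambda>x z :: 'a. 0"])
  qed
qed

end
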